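(* Let $C\subset\mathbb{R}^n$ be closed, let $\varphi:\mathbb{R}^n\to\mathbb{R}^l$ be continuously differentiable, set $Q:=\varphi(C)$, let $\bar y\in Q$, and let $\Psi:\mathbb{R}^l\rightrightarrows\mathbb{R}^n$ be given by $\Psi(y):=\varphi^{-1}(y)\cap C$ (so $\mathrm{dom}\,\Psi=Q$). Suppose that $\Psi$ is inner semicompact at $\bar y$ with respect to $\mathrm{dom}\,\Psi$. Then \[T_Q(\bar y)\supset\bigcup_{\bar x\in\Psi(\bar y)}\nabla\varphi(\bar x)T_C(\bar x).\] The inclusion becomes an equality if $\Psi$ is inner calm* at $\bar y$ with respect to $\mathrm{dom}\,\Psi$ in the fuzzy sense.
   Context: $T_\Omega(\bar z)=\{w:\exists t_k\downarrow0,\,w_k\to w,\ \bar z+t_kw_k\in\Omega\ \forall k\}$ is the tangent (Bouligand) cone; $\nabla\varphi$ is the Jacobian. For $S:\mathbb{R}^p\rightrightarrows\mathbb{R}^q$, $\mathrm{dom}\,S=\{y:S(y)\ne\emptyset\}$ and $\Omega\subset\mathbb{R}^p$: - $S$ is inner semicompact at $\bar y$ with respect to $\Omega$ if for every sequence $y_k\to\bar y$ with $y_k\in\Omega$ there exist an infinite $K\subset\mathbb{N}$ and $x_k\in S(y_k)$ ($k\in K$) converging to some $\bar x$; - $S$ is inner calm* at $\bar y$ with respect to $\Omega$ in the fuzzy sense if for every unit direction $v$, either $v\notin T_\Omega(\bar y)$, or there exist $\kappa_v>0$, a sequence $y_k\in\Omega$ converging to $\bar y$ from $v$ (i.e. $y_k=\bar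 y+t_kv_k$ with $t_k\downarrow0$, $v_k\to v$), $x_k\in S(y_k)$ and a point $\bar x\in\mathbb{R}^q$ with $\|x_k-\bar x\|\le\kappa_v\|y_k-\bar y\|$ for all $k$. *)

theory Defs
  imports "HOL-Analysis.Analysis"
begin

text \<open>
  Set-valued maps are functions into sets.  The notation \<open>t\<^sub>k \<down> 0\<close> is read, as usual in
  variational analysis, as \<open>t\<^sub>k > 0\<close> for all \<open>k\<close> and \<open>t\<^sub>k \<longlonglongrightarrow> 0\<close>; monotonicity is not required
  (it can always be obtained by passing to a subsequence).
\<close>

definition tends_down_to_zero :: "(nat \<Rightarrow> real) \<Rightarrow> bool" where
  "tends_down_to_zero t \<longleftrightarrow> (\<forall>k. 0 < t k) \<and> t \<longlonglongrightarrow> 0"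

definition tangent_cone :: "'a::real_normed_vector set \<Rightarrow> 'a \<Rightarrow> 'a set" where
  "tangent_cone \<Omega> z =
    {w. \<exists>t u. tends_down_to_zero t \<and> u \<longlonglongrightarrow> w \<and> (\<forall>k. z + t k *\<^sub>R u k \<in> \<Omega>)}"

definition sv_dom :: "('a \<Rightarrow> 'b set) \<Rightarrow> 'a set" where
  "sv_dom S = {y. S y \<noteq> {}}"

text \<open>
  The infinite index set \<open>K\<close> is represented by its increasing enumeration \<open>r\<close>, so that
  \<open>x j\<close> stands for the point chosen in \<open>S (y (r j))\<close>.
\<close>

definition inner_semicompact ::
  "('a::real_normed_vector \<Rightarrow> 'b::real_normed_vector set) \<Rightarrow> 'a \<Rightarrow> 'a set \<Rightarrow> bool" where
  "inner_semicompact S ybar \<Omega> \<longleftrightarrow>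
    (\<forall>y::nat \<Rightarrow> 'a. (\<forall>k. y k \<in> \<Omega>) \<and> y \<longlonglongrightarrow> ybar \<longrightarrow>
      (\<exists>(r::nat \<Rightarrow> nat) x xbar. strict_mono r \<and> (\<forall>j. x j \<in> S (y (r j))) \<and> x \<longlonglongrightarrow> xbar))"

definition converges_from ::
  "(nat \<Rightarrow> 'a::real_normed_vector) \<Rightarrow> 'a \<Rightarrow> 'a \<Rightarrow> bool" where
  "converges_from y ybar v \<longleftrightarrow>
    (\<exists>t u. tends_down_to_zero t \<and> u \<longlonglongrightarrow> v \<and> (\<forall>k. y k = ybar + t k *\<^sub>R u k))"

definition inner_calm_star_fuzzy ::
  "('a::real_normed_vector \<Rightarrow> 'b::real_normed_vector set) \<Rightarrow> 'a \<Rightarrow> 'a set \<Rightarrow> bool" where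
  "inner_calm_star_fuzzy S ybar \<Omega> \<longleftrightarrow>
    (\<forall>v. norm v = 1 \<longrightarrow>
      v \<notin> tangent_cone \<Omega> ybar \<or>
      (\<exists>\<kappa>>0. \<exists>y x xbar.
        (\<forall>k. y k \<in> \<Omega>) \<and> converges_from y ybar v \<and> (\<forall>k. x k \<in> S (y k)) \<and>
        (\<forall>k. norm (x k - xbar) \<le> \<kappa> * norm (y k - ybar))))"

definition continuously_differentiable :: "(real^'n \<Rightarrow> real^'m) \<Rightarrow> bool" where
  "continuously_differentiable f \<longleftrightarrow>
    (\<forall>x. f differentiable (at x)) \<and> continuous_on UNIV (\<lambda>x. jacobian f (at x))"

end

theory Submission
  imports Defs
begin

text \<open>
  Everything rests on one fact: along \<open>t\<^sub>k \<down> 0\<close> and \<open>u\<^sub>k \<longlonglongrightarrow> w\<close>, the difference quotients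
  \<open>(f (x + t\<^sub>k u\<^sub>k) - f x) / t\<^sub>k\<close> of a differentiable \<open>f\<close> converge to \<open>f' w\<close>
  (\<open>tendsto_difference_quotient\<close>).  Read forwards, it says that \<open>f\<close> carries a sequence in \<open>C\<close>
  generating the tangent \<open>w\<close> to one in \<open>f ` C\<close> generating \<open>f' w\<close>, which is the inclusion.

  For the converse, a tangent \<open>v\<close> to \<open>f ` C\<close> has to be lifted to a tangent to \<open>C\<close>.  Given a
  sequence \<open>y\<^sub>k = f x\<^sub>k\<close> approaching the base point from \<open>v\<close>, inner calmness* bounds the speed
  at which the preimages \<open>x\<^sub>k\<close> approach some \<open>z\<close>: the vectors \<open>(x\<^sub>k - z) / t\<^sub>k\<close> stay bounded.
  A cluster point \<open>w\<close> of them is tangent to \<open>C\<close> at \<open>z\<close>, and the difference quotients of \<open>f\<close>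
  along this subsequence converge both to \<open>v\<close> and to \<open>f' w\<close>
  (\<open>tangent_lift_of_calm_preimages\<close>).  The calmness condition speaks of unit directions only;
  a nonzero \<open>v\<close> is normalized first, and the zero direction is the image of the zero tangent
  at any preimage of the base point.
\<close>

lemma tends_down_to_zero_compose:
  assumes "tends_down_to_zero t" "strict_mono r"
  shows "tends_down_to_zero (t \<circ> r)"
  using assms LIMSEQ_subseq_LIMSEQ unfolding tends_down_to_zero_def by (auto simp: o_def)

lemma tangent_coneI:
  assumes "tends_down_to_zero t" "u \<longlonglongrightarrow> w" "\<And>k. z + t k *\<^sub>R u k \<in> \<Omega>"
  shows "w \<in> tangent_cone \<Omega> z"
  using assms unfolding tangent_cone_def by blast

lemma tangent_cone_scaleR:
  assumes "w \<in> tangent_cone \<Omega> z" "0 < c"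
  shows "c *\<^sub>R w \<in> tangent_cone \<Omega> z"
proof -
  obtain t u where t: "tends_down_to_zero t" and u: "u \<longlonglongrightarrow> w"
    and mem: "\<And>k. z + t k *\<^sub>R u k \<in> \<Omega>"
    using assms(1) unfolding tangent_cone_def by blast
  show ?thesis
  proof (rule tangent_coneI)
    show "tends_down_to_zero (\<lambda>k. t k / c)"
      using t assms(2) tendsto_divide_zero unfolding tends_down_to_zero_def by auto
    show "(\<lambda>k. c *\<^sub>R u k) \<longlonglongrightarrow> c *\<^sub>R w"
      by (intro tendsto_intros u)
    show "z + (t k / c) *\<^sub>R c *\<^sub>R u k \<in> \<Omega>" for k
      using mem[of k] assms(2) by simp
  qed
qed

lemma zero_in_tangent_cone:
  assumes "z \<in> \<Omega>"
  shows "0 \<in> tangent_cone \<Omega> z"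
proof (rule tangent_coneI)
  show "tends_down_to_zero (\<lambda>k. inverse (real (Suc k)))"
    using LIMSEQ_inverse_real_of_nat unfolding tends_down_to_zero_def by auto
  show "(\<lambda>_::nat. 0) \<longlonglongrightarrow> (0::'a)"
    by simp
qed (use assms in simp)

text \<open>
  Differentiability gives \<open>f (x + h) - f x = f' h + norm h \<cdot> o(1)\<close>; for \<open>h = t\<^sub>k u\<^sub>k\<close> the
  remainder divided by \<open>t\<^sub>k\<close> is \<open>norm u\<^sub>k \<cdot> o(1)\<close>, and \<open>norm u\<^sub>k\<close> is bounded.
\<close>

lemma tendsto_difference_quotient:
  fixes f :: "'a::real_normed_vector \<Rightarrow> 'b::real_normed_vector"
  assumes f: "(f has_derivative f') (at x)"
    and t: "tends_down_to_zero t" and u: "u \<longlonglongrightarrow> w"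
  shows "(\<lambda>k. (f (x + t k *\<^sub>R u k) - f x) /\<^sub>R t k) \<longlonglongrightarrow> f' w"
proof -
  have lin: "bounded_linear f'"
    using f by (rule has_derivative_bounded_linear)
  have tpos: "0 < t k" for k
    using t unfolding tends_down_to_zero_def by blast
  have t0: "t \<longlonglongrightarrow> 0"
    using t unfolding tends_down_to_zero_def by blast
  define \<rho> where "\<rho> h = norm (f (x + h) - f x - f' h) / norm h" for h
  \<comment> \<open>Division by zero yields \<open>\<rho> 0 = 0\<close>, so \<open>\<rho>\<close> is continuous at 0; this covers indices
    with \<open>u\<^sub>k = 0\<close>.\<close>
  have "\<rho> \<midarrow>0\<rightarrow> \<rho> 0"
    using f unfolding has_derivative_at \<rho>_def by simp
  moreover have "(\<lambda>k. t k *\<^sub>R u k) \<longlonglongrightarrow> 0"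
    using tendsto_scaleR[OF t0 u] by simp
  ultimately have "(\<lambda>k. \<rho> (t k *\<^sub>R u k)) \<longlonglongrightarrow> 0"
    using isCont_tendsto_compose[of 0 \<rho>] unfolding isCont_def \<rho>_def by fastforce
  then have "(\<lambda>k. \<rho> (t k *\<^sub>R u k) * norm (u k)) \<longlonglongrightarrow> 0"
    using tendsto_mult[OF _ tendsto_norm[OF u]] by fastforce
  moreover have "norm ((f (x + t k *\<^sub>R u k) - f x) /\<^sub>R t k - f' (u k))
      = \<rho> (t k *\<^sub>R u k) * norm (u k)" for k
  proof -
    have "(f (x + t k *\<^sub>R u k) - f x) /\<^sub>R t k - f' (u k)
        = (f (x + t k *\<^sub>R u k) - f x - f' (t k *\<^sub>R u k)) /\<^sub>R t k"
      using tpos[of k] by (simp add: linear_scale[OF bounded_linear.linear[OF lin]] scaleR_diff_right)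
    then show ?thesis
      using tpos[of k] linear_0[OF bounded_linear.linear[OF lin]]
      by (cases "u k = 0") (auto simp: \<rho>_def divide_simps)
  qed
  ultimately have "(\<lambda>k. (f (x + t k *\<^sub>R u k) - f x) /\<^sub>R t k - f' (u k)) \<longlonglongrightarrow> 0"
    by (subst tendsto_norm_zero_iff[symmetric]) simp
  from tendsto_add[OF this bounded_linear.tendsto[OF lin u]] show ?thesis
    by simp
qed

lemma derivative_in_tangent_cone_image:
  assumes f: "(f has_derivative f') (at x)" and w: "w \<in> tangent_cone C x"
  shows "f' w \<in> tangent_cone (f ` C) (f x)"
proof -
  obtain t u where t: "tends_down_to_zero t" and u: "u \<longlonglongrightarrow> w"
    and mem: "\<And>k. x + t k *\<^sub>R u k \<in> C"
    using w unfolding tangent_cone_def by blast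
  have "t k \<noteq> 0" for k
    using t unfolding tends_down_to_zero_def by (metis less_irrefl)
  then show ?thesis
    using mem by (intro tangent_coneI[OF t tendsto_difference_quotient[OF f t u]]) simp
qed

text \<open>
  Calm convergence of the preimages bounds \<open>(x\<^sub>k - z) / t\<^sub>k\<close>, hence it has a cluster point in the
  finite-dimensional domain.  The bound also forces \<open>x\<^sub>k \<longlonglongrightarrow> z\<close>, so that \<open>z\<close> lies in the closed
  set \<open>C\<close> and, by continuity, over the base point.
\<close>

lemma tangent_lift_of_calm_preimages:
  fixes f :: "'a::euclidean_space \<Rightarrow> 'b::real_normed_vector"
  assumes "closed C" and f: "(f has_derivative f') (at z)"
    and "converges_from y ybar v"
    and xC: "\<And>k. x k \<in> C" and fx: "\<And>k. f (x k) = y k"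
    and calm: "\<And>k. norm (x k - z) \<le> \<kappa> * norm (y k - ybar)"
  obtains w where "z \<in> C" "f z = ybar" "w \<in> tangent_cone C z" "f' w = v"
proof -
  obtain t u where t: "tends_down_to_zero t" and u: "u \<longlonglongrightarrow> v"
    and y: "\<And>k. y k = ybar + t k *\<^sub>R u k"
    using assms(3) unfolding converges_from_def by blast
  have tpos: "0 < t k" for k
    using t unfolding tends_down_to_zero_def by blast
  have t0: "t \<longlonglongrightarrow> 0"
    using t unfolding tends_down_to_zero_def by blast
  have y_lim: "y \<longlonglongrightarrow> ybar"
    using tendsto_add[OF tendsto_const tendsto_scaleR[OF t0 u], of ybar]
    unfolding y[symmetric] by simp
  have "(\<lambda>k. \<kappa> * norm (y k - ybar)) \<longlonglongrightarrow> 0"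
    using tendsto_mult[OF tendsto_const tendsto_norm[OF LIM_zero[OF y_lim]], of \<kappa>] by simp
  then have x_lim: "x \<longlonglongrightarrow> z"
    using calm by (metis (no_types, lifting) LIM_zero_cancel Lim_null_comparison always_eventually)
  have "z \<in> C"
    using \<open>closed C\<close> xC x_lim closed_sequentially by blast
  have "(\<lambda>k. f (x k)) \<longlonglongrightarrow> f z"
    using has_derivative_continuous[OF f] x_lim by (rule isCont_tendsto_compose)
  then have fz: "f z = ybar"
    using y_lim LIMSEQ_unique unfolding fx by blast
  define q where "q k = (x k - z) /\<^sub>R t k" for k
  have x_q: "x k = z + t k *\<^sub>R q k" for k
    using tpos[of k] by (simp add: q_def)
  have q_bound: "norm (q k) \<le> \<kappa> * norm (u k)" for k
    using calm[of k] tpos[of k] by (simp add: q_def y divide_simps mult_ac)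
  have "bounded (range (\<lambda>k. \<kappa> *\<^sub>R u k))"
    by (rule convergent_imp_bounded[OF tendsto_scaleR[OF tendsto_const u]])
  then obtain B where B: "\<And>k. norm (\<kappa> *\<^sub>R u k) \<le> B"
    unfolding bounded_iff by blast
  have "norm (q k) \<le> B" for k
  proof -
    have "norm (q k) \<le> \<bar>\<kappa>\<bar> * norm (u k)"
      using q_bound[of k] by (meson abs_ge_self mult_right_mono norm_ge_zero order_trans)
    then show ?thesis
      using B[of k] by simp
  qed
  then have "bounded (range q)"
    unfolding bounded_iff by blast
  then obtain w r where r: "strict_mono r" and q_lim: "(q \<circ> r) \<longlonglongrightarrow> w"
    using bounded_imp_convergent_subsequence by blast
  have tr: "tends_down_to_zero (t \<circ> r)"
    using t r by (rule tends_down_to_zero_compose)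
  have "w \<in> tangent_cone C z"
    using xC x_q by (intro tangent_coneI[OF tr q_lim]) (metis comp_apply)
  moreover have "f' w = v"
  proof (rule LIMSEQ_unique)
    show "(\<lambda>k. (f (z + (t \<circ> r) k *\<^sub>R (q \<circ> r) k) - f z) /\<^sub>R (t \<circ> r) k) \<longlonglongrightarrow> f' w"
      using f tr q_lim by (rule tendsto_difference_quotient)
    have "(f (z + (t \<circ> r) k *\<^sub>R (q \<circ> r) k) - f z) /\<^sub>R (t \<circ> r) k = (u \<circ> r) k" for k
      using tpos[of "r k"] by (simp add: x_q[symmetric] fx y fz)
    then show "(\<lambda>k. (f (z + (t \<circ> r) k *\<^sub>R (q \<circ> r) k) - f z) /\<^sub>R (t \<circ> r) k) \<longlonglongrightarrow> v"
      using LIMSEQ_subseq_LIMSEQ[OF u r] by presburger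
  qed
  ultimately show thesis
    using that \<open>z \<in> C\<close> fz by blast
qed

theorem corollary4p2:
  fixes C :: "(real^'n) set"
    and \<phi> :: "real^'n \<Rightarrow> real^'l"
    and Q :: "(real^'l) set"
    and \<Psi> :: "real^'l \<Rightarrow> (real^'n) set"
    and ybar :: "real^'l"
  assumes "closed C"
    and "continuously_differentiable \<phi>"
    and "Q = \<phi> ` C"
    and "ybar \<in> Q"
    and "\<And>y. \<Psi> y = \<phi> -` {y} \<inter> C"
    and "inner_semicompact \<Psi> ybar (sv_dom \<Psi>)"
  shows "(\<Union>xbar \<in> \<Psi> ybar. (\<lambda>w. jacobian \<phi> (at xbar) *v w) ` tangent_cone C xbar)
           \<subseteq> tangent_cone Q ybar
       \<and> (inner_calm_star_fuzzy \<Psi> ybar (sv_dom \<Psi>) \<longrightarrow>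
           tangent_cone Q ybar
             = (\<Union>xbar \<in> \<Psi> ybar. (\<lambda>w. jacobian \<phi> (at xbar) *v w) ` tangent_cone C xbar))"
    (is "?U \<subseteq> _ \<and> (?calm \<longrightarrow> _)")
proof -
  have deriv: "(\<phi> has_derivative (\<lambda>h. jacobian \<phi> (at x) *v h)) (at x)" for x
    using assms(2) unfolding continuously_differentiable_def by (simp add: jacobian_works)
  have \<Psi>_iff: "x \<in> \<Psi> y \<longleftrightarrow> x \<in> C \<and> \<phi> x = y" for x y
    using assms(5) by auto
  have dom: "sv_dom \<Psi> = Q"
    using assms(3) \<Psi>_iff by (auto simp: sv_dom_def simp flip: ex_in_conv)
  have incl: "?U \<subseteq> tangent_cone Q ybar"
    using derivative_in_tangent_cone_image[OF deriv] assms(3) \<Psi>_iff by auto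
  have "v \<in> ?U" if calm: ?calm and v: "v \<in> tangent_cone Q ybar" for v
  proof (cases "v = 0")
    case True
    obtain x where x: "x \<in> \<Psi> ybar"
      using assms(3,4) \<Psi>_iff by blast
    then have "0 \<in> tangent_cone C x"
      using zero_in_tangent_cone \<Psi>_iff by blast
    moreover have "v = jacobian \<phi> (at x) *v 0"
      using True by simp
    ultimately show ?thesis
      using x by blast
  next
    case False
    define e where "e = v /\<^sub>R norm v"
    have "norm e = 1" "e \<in> tangent_cone (sv_dom \<Psi>) ybar"
      using False tangent_cone_scaleR[OF v] dom by (auto simp: e_def)
    then obtain \<kappa> y x z where "converges_from y ybar e" "\<And>k. x k \<in> \<Psi> (y k)"
      "\<And>k. norm (x k - z) \<le> \<kappa> * norm (y k - ybar)"
      using calm unfolding inner_calm_star_fuzzy_def by blast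
    then obtain w where z: "z \<in> \<Psi> ybar" and w: "w \<in> tangent_cone C z"
      and e: "jacobian \<phi> (at z) *v w = e"
      using tangent_lift_of_calm_preimages[OF assms(1) deriv] \<Psi>_iff by metis
    have "norm v *\<^sub>R w \<in> tangent_cone C z"
      using tangent_cone_scaleR[OF w] False by simp
    moreover have "v = jacobian \<phi> (at z) *v (norm v *\<^sub>R w)"
      using False by (simp add: matrix_vector_mult_scaleR e) (simp add: e_def)
    ultimately show ?thesis
      using z by blast
  qed
  with incl show ?thesis
    by blast
qed

end
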